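(* Let $(A,J)$ and $(B,K)$ be flip pairs. If there is a half elementary equivalence $(R,S)$ from $(A,J)$ to $(B,K)$, then $(\mathsf{X}_A,\sigma_A,\varphi_{A,J})$ is skew $D_\infty$-conjugate to $(\mathsf{X}_B,\sigma_B,\varphi_{B,K})$; that is, $(\mathsf{X}_A,\sigma_A,\varphi_{A,J})$ and $(\mathsf{X}_B,\sigma_B,\sigma_B\circ\varphi_{B,K})$ are $D_\infty$-conjugate.
   Context: Flip systems. Let $T$ be a homeomorphism of a topological space $X$. A flip for $(X,T)$ is a homeomorphism $\varphi:X\to X$ with $\varphi\circ T=T^{-1}\circ\varphi$ and $\varphi^2=\mathrm{id}_X$; then $(X,T,\varphi)$ is called a flip system. If $(X,T,\varphi)$ is a flip system, so is $(X,T,T\circ\varphi)$. Two flip systems $(X,T,\varphi)$ and $(Y,S,\psi)$ are $D_\infty$-conjugate if there is a homeomorphism $\theta:X\to Y$ with $\theta\circ T=S\circ\theta$ and $\theta\circ\varphi=\psi\circ\theta$. They are skew $D_\infty$-conjugate if $(X,T,\varphi)$ and $(Y,S,S\circ\psi)$ are $D_\infty$-conjugate. Flip pairs. Let $\mathcal{A}$ be a finite set. A pair $(A,J)$ of zero-one $\mathcal{A}\times\mathcal{A}$ matrices is a flip pair if $JA=A^{\mathsf T}J$ and $J^2=I$. There is then a unique map $\tau_J:\mathcal{A}\to\mathcal{A}$ with $J(a,b)=1$ if and only if $\tau_J(a)=b$, and $\tau_J^2=\mathrm{id}$. Let $\mathsf{X}_A=\{x\in\mathcal{A}^{\mathbb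 Z}: A(x_i,x_{i+1})=1\ \text{for all } i\in\mathbb{Z}\}$ (a subspace of $\mathcal{A}^{\mathbb Z}$ with the product topology, $\mathcal{A}$ discrete), let $\sigma_A$ be the restriction to $\mathsf{X}_A$ of the shift map $\sigma(x)_i=x_{i+1}$, and let $\varphi_{A,J}:\mathsf{X}_A\to\mathsf{X}_A$ be given by $\varphi_{A,J}(x)_i=\tau_J(x_{-i})$; it is a flip for $(\mathsf{X}_A,\sigma_A)$. Let $(A,J)$ and $(B,K)$ be flip pairs, indexed by finite sets $\mathcal{A}$ and $\mathcal{B}$ respectively. A half elementary equivalence from $(A,J)$ to $(B,K)$ is a pair $(R,S)$ of zero-one matrices ($R$ is $\mathcal{A}\times\mathcal{B}$, $S$ is $\mathcal{B}\times\mathcal{A}$) satisfying $A=RS$, $B=SR$ and $S=KR^{\mathsf T}J$. *)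

theory Defs
  imports "HOL-Analysis.Analysis"
begin

section \<open>Flip systems\<close>

text \<open>
  A space is a value of type \<open>'x topology\<close>; maps are total HOL functions of which only the
  behaviour on \<open>topspace\<close> matters. Accordingly the inverse of \<open>T\<close> and all
  commutation relations are taken relative to \<open>topspace\<close>.
\<close>

definition flip_system :: "'x topology \<Rightarrow> ('x \<Rightarrow> 'x) \<Rightarrow> ('x \<Rightarrow> 'x) \<Rightarrow> bool" where
  "flip_system X T \<phi> \<longleftrightarrow>
     homeomorphic_map X X T \<and> homeomorphic_map X X \<phi> \<and>
     (\<forall>x\<in>topspace X. \<phi> (T x) = inv_into (topspace X) T (\<phi> x)) \<and>
     (\<forall>x\<in>topspace X. \<phi> (\<phi> x) = x)"

definition D_infinity_conjugate ::
    "'x topology \<Rightarrow> ('x \<Rightarrow> 'x) \<Rightarrow> ('x \<Rightarrow> 'x) \<Rightarrow>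
     'y topology \<Rightarrow> ('y \<Rightarrow> 'y) \<Rightarrow> ('y \<Rightarrow> 'y) \<Rightarrow> bool" where
  "D_infinity_conjugate X T \<phi> Y S \<psi> \<longleftrightarrow>
     flip_system X T \<phi> \<and> flip_system Y S \<psi> \<and>
     (\<exists>\<theta>. homeomorphic_map X Y \<theta> \<and>
          (\<forall>x\<in>topspace X. \<theta> (T x) = S (\<theta> x)) \<and>
          (\<forall>x\<in>topspace X. \<theta> (\<phi> x) = \<psi> (\<theta> x)))"

definition skew_D_infinity_conjugate ::
    "'x topology \<Rightarrow> ('x \<Rightarrow> 'x) \<Rightarrow> ('x \<Rightarrow> 'x) \<Rightarrow>
     'y topology \<Rightarrow> ('y \<Rightarrow> 'y) \<Rightarrow> ('y \<Rightarrow> 'y) \<Rightarrow> bool" where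
  "skew_D_infinity_conjugate X T \<phi> Y S \<psi> \<longleftrightarrow>
     flip_system X T \<phi> \<and> flip_system Y S \<psi> \<and>
     D_infinity_conjugate X T \<phi> Y S (S \<circ> \<psi>)"


section \<open>Flip pairs\<close>

text \<open>
  Zero-one matrices are integer matrices, so that products are computed in characteristic zero.
  The type \<open>int ^ 'b ^ 'a\<close> is that of matrices with rows indexed by \<open>'a\<close> and
  columns indexed by \<open>'b\<close>.
\<close>

definition zero_one_matrix :: "int ^ 'b ^ 'a \<Rightarrow> bool" where
  "zero_one_matrix M \<longleftrightarrow> (\<forall>i j. M $ i $ j \<in> {0, 1})"

definition flip_pair :: "int ^ 'a ^ 'a \<Rightarrow> int ^ 'a ^ 'a \<Rightarrow> bool" where
  "flip_pair A J \<longleftrightarrow>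
     zero_one_matrix A \<and> zero_one_matrix J \<and>
     J ** A = transpose A ** J \<and> J ** J = mat 1"

definition tau :: "int ^ 'a ^ 'a \<Rightarrow> 'a \<Rightarrow> 'a" where
  "tau J a = (THE b. J $ a $ b = 1)"

definition shift_space :: "int ^ 'a ^ 'a \<Rightarrow> (int \<Rightarrow> 'a) topology" where
  "shift_space A =
     subtopology (product_topology (\<lambda>_. discrete_topology UNIV) UNIV)
       {x. \<forall>i. A $ x i $ x (i + 1) = 1}"

definition shift :: "(int \<Rightarrow> 'a) \<Rightarrow> int \<Rightarrow> 'a" where
  "shift x = (\<lambda>i. x (i + 1))"

text \<open>The matrix \<open>A\<close> enters only through the domain \<open>shift_space A\<close>.\<close>

definition flip_map :: "int ^ 'a ^ 'a \<Rightarrow> (int \<Rightarrow> 'a) \<Rightarrow> int \<Rightarrow> 'a" where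
  "flip_map J x = (\<lambda>i. tau J (x (- i)))"

definition half_elementary_equivalence ::
    "int ^ 'a ^ 'a \<Rightarrow> int ^ 'a ^ 'a \<Rightarrow> int ^ 'b ^ 'b \<Rightarrow> int ^ 'b ^ 'b \<Rightarrow>
     int ^ 'b ^ 'a \<Rightarrow> int ^ 'a ^ 'b \<Rightarrow> bool" where
  "half_elementary_equivalence A J B K R S \<longleftrightarrow>
     zero_one_matrix R \<and> zero_one_matrix S \<and>
     A = R ** S \<and> B = S ** R \<and> S = K ** transpose R ** J"

end

theory Submission
  imports Defs
begin

text \<open>
  The factorisation \<open>A = R S\<close> with all matrices zero-one means that each allowed transition
  \<open>a \<rightarrow> a'\<close> of \<open>A\<close> passes through exactly one \<open>b\<close> with \<open>R a b = S b a' = 1\<close>, and likewise each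
  transition of \<open>B\<close> through exactly one intermediate symbol of \<open>A\<close>. Reading off the intermediate
  symbols is a two-block conjugacy \<open>\<theta>\<close> between the shift spaces. The relation \<open>S = K R\<^sup>T J\<close> says that
  \<open>S b a = R (\<tau>\<^sub>J a) (\<tau>\<^sub>K b)\<close>, so flipping a point reverses the order of its transitions and applies
  \<open>\<tau>\<^sub>K\<close> to the intermediate symbols: \<open>\<theta> (\<phi> x) i = \<tau>\<^sub>K (\<theta> x (- i - 1))\<close>. The offset by one is the extra shift in
  the skew conjugacy.
\<close>

section \<open>Flip systems\<close>

text \<open>Applying \<open>T\<close> to both sides frees the commutation relation of
  \<open>inv_into\<close>; injectivity of \<open>T\<close> on the carrier recovers the original
  form.\<close>

lemma flip_systemI:
  assumes T: "homeomorphic_map X X T" and \<phi>: "homeomorphic_map X X \<phi>"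
    and TT: "\<And>x. x \<in> topspace X \<Longrightarrow> T (\<phi> (T x)) = \<phi> x"
    and inv: "\<And>x. x \<in> topspace X \<Longrightarrow> \<phi> (\<phi> x) = x"
  shows "flip_system X T \<phi>"
  unfolding flip_system_def
proof (intro conjI ballI)
  fix x assume x: "x \<in> topspace X"
  have im: "T ` topspace X = topspace X" "\<phi> ` topspace X = topspace X"
    using T \<phi> homeomorphic_imp_surjective_map by blast+
  have "inj_on T (topspace X)"
    using T homeomorphic_imp_injective_map by blast
  moreover have "\<phi> (T x) \<in> topspace X"
    using im x by blast
  ultimately show "\<phi> (T x) = inv_into (topspace X) T (\<phi> x)"
    by (metis TT[OF x] inv_into_f_f)
qed (use assms in auto)

lemma flip_system_conjugate:
  assumes "flip_system X T \<phi>" and x: "x \<in> topspace X"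
  shows "T (\<phi> (T x)) = \<phi> x"
proof -
  have "homeomorphic_map X X T" "homeomorphic_map X X \<phi>"
    using assms by (auto simp: flip_system_def)
  hence "\<phi> x \<in> T ` topspace X"
    using homeomorphic_imp_surjective_map x by blast
  thus ?thesis
    using assms by (auto simp: flip_system_def f_inv_into_f)
qed

text \<open>Conjugacy to the skew system presupposes that the skew system is itself a flip system.
  Both identities reduce to \<open>T (\<phi> (T x)) = \<phi> x\<close>.\<close>

lemma flip_system_comp:
  assumes "flip_system X T \<phi>"
  shows "flip_system X T (T \<circ> \<phi>)"
proof (rule flip_systemI)
  have T: "homeomorphic_map X X T" and \<phi>: "homeomorphic_map X X \<phi>"
    and inv: "\<And>x. x \<in> topspace X \<Longrightarrow> \<phi> (\<phi> x) = x"
    using assms by (auto simp: flip_system_def)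
  show "homeomorphic_map X X T" "homeomorphic_map X X (T \<circ> \<phi>)"
    using T \<phi> homeomorphic_map_compose by blast+
  have "\<phi> x \<in> topspace X" if "x \<in> topspace X" for x
    using homeomorphic_imp_surjective_map[OF \<phi>] that by blast
  thus "T ((T \<circ> \<phi>) (T x)) = (T \<circ> \<phi>) x" "(T \<circ> \<phi>) ((T \<circ> \<phi>) x) = x" if "x \<in> topspace X" for x
    using that inv flip_system_conjugate[OF assms] by simp_all
qed

section \<open>Shift spaces\<close>

lemma topspace_shift_space: "topspace (shift_space A) = {x. \<forall>i. A $ x i $ x (i + 1) = 1}"
  by (simp add: shift_space_def)

text \<open>A product of two discrete spaces is discrete, so any local rule \<open>F\<close> is
  continuous. Two input positions suffice for the shift, its inverse, the flip and both two-block
  codes.\<close>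

lemma continuous_map_shift_space:
  assumes F: "\<And>x i. f x i = F (x (g i)) (x (h i))"
    and im: "\<And>x. x \<in> topspace (shift_space A) \<Longrightarrow> f x \<in> topspace (shift_space B)"
  shows "continuous_map (shift_space A) (shift_space B) f"
proof -
  let ?P = "product_topology (\<lambda>_. discrete_topology UNIV) UNIV"
  have "continuous_map ?P (discrete_topology UNIV) (\<lambda>x. f x i)" for i
  proof -
    have "continuous_map ?P (prod_topology (discrete_topology UNIV) (discrete_topology UNIV))
            (\<lambda>x. (x (g i), x (h i)))"
      by (intro continuous_map_pairedI continuous_map_product_projection) auto
    moreover have "continuous_map (prod_topology (discrete_topology UNIV) (discrete_topology UNIV))
        (discrete_topology UNIV) (case_prod F)"
      by (simp flip: prod_topology_discrete_topology)
    ultimately have "continuous_map ?P (discrete_topology UNIV)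
        (case_prod F \<circ> (\<lambda>x. (x (g i), x (h i))))"
      by (rule continuous_map_compose)
    thus ?thesis by (simp add: o_def F)
  qed
  hence "continuous_map ?P ?P f"
    by (simp add: continuous_map_componentwise_UNIV)
  thus ?thesis
    using im unfolding shift_space_def
    by (auto simp: continuous_map_in_subtopology intro: continuous_map_from_subtopology)
qed

lemma homeomorphic_map_shift: "homeomorphic_map (shift_space A) (shift_space A) shift"
proof -
  have inv: "A $ x (i - 1) $ x i = 1" if "\<forall>i. A $ x i $ x (i + 1) = 1" for x and i :: int
    using that[rule_format, of "i - 1"] by simp
  have "homeomorphic_maps (shift_space A) (shift_space A) shift (\<lambda>x i. x (i - 1))"
    unfolding homeomorphic_maps_def
  proof (intro conjI)
    show "continuous_map (shift_space A) (shift_space A) shift"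
      by (rule continuous_map_shift_space[where F = "\<lambda>a b. a" and g = "\<lambda>i. i + 1"])
        (simp_all only: shift_def topspace_shift_space mem_Collect_eq, blast)
    show "continuous_map (shift_space A) (shift_space A) (\<lambda>x i. x (i - 1))"
      by (rule continuous_map_shift_space[where F = "\<lambda>a b. a" and g = "\<lambda>i. i - 1"])
        (auto simp: topspace_shift_space inv)
  qed (auto simp: shift_def)
  thus ?thesis
    using homeomorphic_map_maps by blast
qed

section \<open>Zero-one matrices\<close>

lemma zero_one_matrix_mult_nth:
  assumes "zero_one_matrix M" "zero_one_matrix N"
  shows "(M ** N) $ i $ j = int (card {k. M $ i $ k = 1 \<and> N $ k $ j = 1})"
proof -
  have "M $ i $ k * N $ k $ j = (if M $ i $ k = 1 \<and> N $ k $ j = 1 then 1 else 0)" for k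
    using assms unfolding zero_one_matrix_def by (metis insert_iff mult_zero_left mult_zero_right
        mult_1 singletonD)
  hence "(M ** N) $ i $ j = (\<Sum>k\<in>UNIV. if M $ i $ k = 1 \<and> N $ k $ j = 1 then 1 else 0)"
    by (simp add: matrix_matrix_mult_def)
  thus ?thesis
    by (simp add: sum.If_cases)
qed

text \<open>Over the integers a product entry counts intermediate symbols, so the value 1 means
  exactly one of them.\<close>

lemma zero_one_matrix_mult_eq_1_iff:
  assumes "zero_one_matrix M" "zero_one_matrix N"
  shows "(M ** N) $ i $ j = 1 \<longleftrightarrow> (\<exists>!k. M $ i $ k = 1 \<and> N $ k $ j = 1)"
proof -
  have "(M ** N) $ i $ j = 1 \<longleftrightarrow> (\<exists>k. {k. M $ i $ k = 1 \<and> N $ k $ j = 1} = {k})"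
    by (simp add: zero_one_matrix_mult_nth[OF assms] card_1_singleton_iff)
  thus ?thesis
    unfolding set_eq_iff mem_Collect_eq singleton_iff by metis
qed

text \<open>One intermediate symbol makes the count nonzero, and a zero-one product leaves 1 as the
  only nonzero value.\<close>

lemma zero_one_matrix_mult_eq_1I:
  assumes "zero_one_matrix M" "zero_one_matrix N" "zero_one_matrix (M ** N)"
    and "M $ i $ k = 1" "N $ k $ j = 1"
  shows "(M ** N) $ i $ j = 1"
proof -
  have "(M ** N) $ i $ j \<noteq> 0"
    using assms(4,5) by (auto simp: zero_one_matrix_mult_nth[OF assms(1,2)])
  thus ?thesis
    using assms(3) by (auto simp: zero_one_matrix_def)
qed

section \<open>Flip pairs\<close>

lemma flip_pair_eq_1_iff:
  assumes "flip_pair A J"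
  shows "J $ a $ b = 1 \<longleftrightarrow> b = tau J a"
proof -
  have J: "zero_one_matrix J" and JJ: "J ** J = mat 1"
    using assms by (auto simp: flip_pair_def)
  have "(J ** J) $ a $ a = 1"
    by (simp add: JJ mat_def)
  then obtain c where c: "J $ a $ c = 1" "J $ c $ a = 1"
    using zero_one_matrix_mult_eq_1_iff[OF J J] by blast
  have uniq: "d = c" if "J $ a $ d = 1" for d
  proof -
    have "zero_one_matrix (J ** J)"
      by (simp add: JJ zero_one_matrix_def mat_def)
    \<comment> \<open>The path from \<open>c\<close> through \<open>a\<close> to \<open>d\<close>
      puts a 1 at position \<open>(c, d)\<close> of the identity matrix.\<close>
    hence "(J ** J) $ c $ d = 1"
      using zero_one_matrix_mult_eq_1I[OF J J] c that by blast
    thus ?thesis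
      by (simp add: JJ mat_def split: if_splits)
  qed
  hence "tau J a = c"
    unfolding tau_def using c by blast
  thus ?thesis
    using c uniq by blast
qed

lemma tau_tau:
  assumes "flip_pair A J"
  shows "tau J (tau J a) = a"
proof -
  have J: "zero_one_matrix J" and "(J ** J) $ a $ a = 1"
    using assms by (auto simp: flip_pair_def mat_def)
  then obtain c where "J $ a $ c = 1" "J $ c $ a = 1"
    using zero_one_matrix_mult_eq_1_iff[OF J J] by blast
  thus ?thesis
    by (simp add: flip_pair_eq_1_iff[OF assms])
qed

lemma flip_pair_nth:
  assumes "flip_pair A J"
  shows "J $ a $ b = (if b = tau J a then 1 else 0)"
  using flip_pair_eq_1_iff[OF assms, of a b] assms
  by (auto simp: flip_pair_def zero_one_matrix_def)

lemma flip_pair_mult_left: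
  fixes M :: "int ^ 'c ^ 'a::finite"
  assumes "flip_pair A J"
  shows "(J ** M) $ a $ c = M $ tau J a $ c"
  by (simp add: matrix_matrix_mult_def flip_pair_nth[OF assms] if_distrib[of "\<lambda>x. x * _"] cong: if_cong)

lemma flip_pair_mult_right:
  fixes M :: "int ^ 'a::finite ^ 'c"
  assumes "flip_pair A J"
  shows "(M ** J) $ c $ a = M $ c $ tau J a"
proof -
  \<comment> \<open>The product sums over those \<open>d\<close> that \<open>tau J\<close> sends to
    \<open>a\<close>; the involution leaves only \<open>d = tau J a\<close>.\<close>
  have "a = tau J d \<longleftrightarrow> d = tau J a" for d
    using tau_tau[OF assms] by metis
  thus ?thesis
    by (simp add: matrix_matrix_mult_def flip_pair_nth[OF assms] if_distrib[of "\<lambda>x. _ * x"] cong: if_cong)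
qed

lemma flip_pair_tau:
  assumes "flip_pair A J"
  shows "A $ tau J a $ tau J b = A $ b $ a"
proof -
  \<comment> \<open>The column \<open>tau J b\<close> is chosen so that right multiplication by
    \<open>J\<close> leads back to \<open>b\<close>.\<close>
  have "(J ** A) $ a $ tau J b = (transpose A ** J) $ a $ tau J b"
    using assms by (simp add: flip_pair_def)
  thus ?thesis
    by (simp add: flip_pair_mult_left[OF assms] flip_pair_mult_right[OF assms] tau_tau[OF assms]
        transpose_def)
qed

lemma flip_map_in_shift_space:
  assumes "flip_pair A J" "x \<in> topspace (shift_space A)"
  shows "flip_map J x \<in> topspace (shift_space A)"
proof -
  have "A $ x (- i - 1) $ x (- i) = 1" for i
    using assms(2)[unfolded topspace_shift_space, simplified, rule_format, of "- i - 1"] by simp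
  thus ?thesis
    by (simp add: flip_map_def topspace_shift_space flip_pair_tau[OF assms(1)])
qed

lemma flip_system_shift_space:
  assumes "flip_pair A J"
  shows "flip_system (shift_space A) shift (flip_map J)"
proof (rule flip_systemI)
  have inv: "flip_map J (flip_map J x) = x" for x
    by (simp add: flip_map_def tau_tau[OF assms])
  have "continuous_map (shift_space A) (shift_space A) (flip_map J)"
    by (rule continuous_map_shift_space[where F = "\<lambda>a b. tau J a" and g = uminus])
      (simp_all add: flip_map_in_shift_space[OF assms], simp add: flip_map_def)
  \<comment> \<open>An involution is its own inverse, so one continuity proof serves both
    directions.\<close>
  hence "homeomorphic_maps (shift_space A) (shift_space A) (flip_map J) (flip_map J)"
    by (simp add: homeomorphic_maps_def inv)
  thus "homeomorphic_map (shift_space A) (shift_space A) (flip_map J)"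
    using homeomorphic_map_maps by blast
  show "flip_map J (flip_map J x) = x" for x
    by (rule inv)
qed (simp_all add: homeomorphic_map_shift, simp add: shift_def flip_map_def)

section \<open>Half elementary equivalences\<close>

text \<open>The value is meaningful only where the product entry is 1. Elsewhere it is unspecified,
  which is harmless because only transitions of points in the shift space matter.\<close>

definition middle :: "int ^ 'b ^ 'a \<Rightarrow> int ^ 'c ^ 'b \<Rightarrow> 'a \<Rightarrow> 'c \<Rightarrow> 'b" where
  "middle M N a c = (THE b. M $ a $ b = 1 \<and> N $ b $ c = 1)"

lemma middle_eq_iff:
  assumes "zero_one_matrix M" "zero_one_matrix N" "(M ** N) $ a $ c = 1"
  shows "middle M N a c = b \<longleftrightarrow> M $ a $ b = 1 \<and> N $ b $ c = 1"
proof -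
  have ex1: "\<exists>!b. M $ a $ b = 1 \<and> N $ b $ c = 1"
    using assms zero_one_matrix_mult_eq_1_iff by blast
  show ?thesis
    unfolding middle_def using theI'[OF ex1] ex1 by blast
qed

lemma homeomorphic_map_middle:
  assumes R: "zero_one_matrix R" and S: "zero_one_matrix S"
    and RS: "zero_one_matrix (R ** S)" and SR: "zero_one_matrix (S ** R)"
  shows "homeomorphic_map (shift_space (R ** S)) (shift_space (S ** R))
           (\<lambda>x i. middle R S (x i) (x (i + 1)))"
    (is "homeomorphic_map ?X ?Y ?\<theta>")
proof -
  \<comment> \<open>As \<open>?\<theta> x i\<close> sits between \<open>x i\<close> and
    \<open>x (i + 1)\<close>, the symbol \<open>x i\<close> sits between entries
    \<open>i - 1\<close> and \<open>i\<close> of \<open>?\<theta> x\<close>; hence the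
    offset.\<close>
  let ?\<eta> = "\<lambda>y i. middle S R (y (i - 1)) (y i)"
  note eqX = middle_eq_iff[OF R S] and eqY = middle_eq_iff[OF S R]
  have \<theta>: "R $ x i $ ?\<theta> x i = 1" "S $ ?\<theta> x i $ x (i + 1) = 1" "S $ ?\<theta> x (i - 1) $ x i = 1"
    if "x \<in> topspace ?X" for x i
  proof -
    have *: "(R ** S) $ x j $ x (j + 1) = 1" for j
      using that by (simp add: topspace_shift_space)
    show "R $ x i $ ?\<theta> x i = 1" "S $ ?\<theta> x i $ x (i + 1) = 1" "S $ ?\<theta> x (i - 1) $ x i = 1"
      using eqX[OF *[of i]] eqX[OF *[of "i - 1"]] by auto
  qed
  have \<eta>: "S $ y (i - 1) $ ?\<eta> y i = 1" "R $ ?\<eta> y i $ y i = 1" "S $ y i $ ?\<eta> y (i + 1) = 1"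
    if "y \<in> topspace ?Y" for y i
  proof -
    have *: "(S ** R) $ y j $ y (j + 1) = 1" for j
      using that by (simp add: topspace_shift_space)
    show "S $ y (i - 1) $ ?\<eta> y i = 1" "R $ ?\<eta> y i $ y i = 1" "S $ y i $ ?\<eta> y (i + 1) = 1"
      using eqY[OF *[of i]] eqY[OF *[of "i - 1", simplified]] by auto
  qed
  have \<theta>_in: "?\<theta> x \<in> topspace ?Y" if "x \<in> topspace ?X" for x
    unfolding topspace_shift_space
    using zero_one_matrix_mult_eq_1I[OF S R SR] \<theta>[OF that] by blast
  have \<eta>_in: "?\<eta> y \<in> topspace ?X" if "y \<in> topspace ?Y" for y
    unfolding topspace_shift_space
    using zero_one_matrix_mult_eq_1I[OF R S RS] \<eta>[OF that] by blast
  have "homeomorphic_maps ?X ?Y ?\<theta> ?\<eta>"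
    unfolding homeomorphic_maps_def
  proof (intro conjI ballI)
    show "continuous_map ?X ?Y ?\<theta>"
      by (rule continuous_map_shift_space[where F = "middle R S" and g = "\<lambda>i. i" and h = "\<lambda>i. i + 1"])
        (use \<theta>_in in auto)
    show "continuous_map ?Y ?X ?\<eta>"
      by (rule continuous_map_shift_space[where F = "middle S R" and g = "\<lambda>i. i - 1" and h = "\<lambda>i. i"])
        (use \<eta>_in in auto)
    show "?\<eta> (?\<theta> x) = x" if x: "x \<in> topspace ?X" for x
    proof
      fix i
      show "?\<eta> (?\<theta> x) i = x i"
        \<comment> \<open>\<open>x i\<close> joins \<open>?\<theta> x (i - 1)\<close> to
          \<open>?\<theta> x i\<close>, and only one symbol does.\<close>
        by (rule eqY[THEN iffD2]) (use \<theta>[OF x] zero_one_matrix_mult_eq_1I[OF S R SR] in blast)+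
    qed
    show "?\<theta> (?\<eta> y) = y" if y: "y \<in> topspace ?Y" for y
    proof
      fix i
      show "?\<theta> (?\<eta> y) i = y i"
        by (rule eqX[THEN iffD2]) (use \<eta>[OF y] zero_one_matrix_mult_eq_1I[OF R S RS] in blast)+
    qed
  qed
  thus ?thesis
    using homeomorphic_map_maps by blast
qed

theorem proposition2p2:
  fixes A J :: "int ^ 'a::finite ^ 'a"
    and B K :: "int ^ 'b::finite ^ 'b"
    and R :: "int ^ 'b ^ 'a"
    and S :: "int ^ 'a ^ 'b"
  assumes "flip_pair A J"
    and "flip_pair B K"
    and "half_elementary_equivalence A J B K R S"
  shows "skew_D_infinity_conjugate
           (shift_space A) shift (flip_map J)
           (shift_space B) shift (flip_map K)"
proof -
  have R: "zero_one_matrix R" and S: "zero_one_matrix S"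
    and A: "A = R ** S" and B: "B = S ** R" and SR: "S = K ** transpose R ** J"
    using assms(3) by (auto simp: half_elementary_equivalence_def)
  have zA: "zero_one_matrix (R ** S)" and zB: "zero_one_matrix (S ** R)"
    using assms(1,2) by (auto simp: flip_pair_def A B)
  note tJ = tau_tau[OF assms(1)] and tK = tau_tau[OF assms(2)]
  \<comment> \<open>Under the two involutions, edges of \<open>R\<close> become reversed edges of
    \<open>S\<close> and conversely.\<close>
  have S_nth: "S $ b $ a = R $ tau J a $ tau K b" for a b
    by (subst SR) (simp add: flip_pair_mult_left[OF assms(2)] flip_pair_mult_right[OF assms(1)]
        transpose_def)
  define \<theta> where "\<theta> = (\<lambda>x (i::int). middle R S (x i) (x (i + 1)))"
  have homeo: "homeomorphic_map (shift_space A) (shift_space B) \<theta>"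
    unfolding \<theta>_def A B by (rule homeomorphic_map_middle[OF R S zA zB])
  have "\<theta> (flip_map J x) = (shift \<circ> flip_map K) (\<theta> x)" if x: "x \<in> topspace (shift_space A)" for x
  proof
    fix i :: int
    have x1: "(R ** S) $ x j $ x (j + 1) = 1" for j
      using x by (simp add: topspace_shift_space A)
    \<comment> \<open>The transition of the flipped point from \<open>i\<close> to
      \<open>i + 1\<close> reverses that of \<open>x\<close> from \<open>- i - 1\<close> to
      \<open>- i\<close>, whose middle symbol is \<open>c\<close>.\<close>
    define c where "c = \<theta> x (- i - 1)"
    have "R $ x (- i - 1) $ c = 1 \<and> S $ c $ x (- i) = 1"
      using middle_eq_iff[OF R S x1[of "- i - 1"], THEN iffD1, OF refl] by (simp add: c_def \<theta>_def)
    moreover have "(R ** S) $ flip_map J x i $ flip_map J x (i + 1) = 1"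
      using flip_map_in_shift_space[OF assms(1) x] by (simp add: topspace_shift_space A)
    \<comment> \<open>By \<open>S_nth\<close> the two edges at \<open>c\<close> turn into edges at
      \<open>tau K c\<close>, which is therefore the middle symbol of the flipped
      transition.\<close>
    ultimately have "\<theta> (flip_map J x) i = tau K c"
      unfolding \<theta>_def using middle_eq_iff[OF R S]
      by (simp add: flip_map_def S_nth tJ tK)
    \<comment> \<open>The flip alone would read \<open>\<theta> x\<close> at \<open>- i\<close>; the
      shift after it moves this to \<open>- (i + 1)\<close>, the index of \<open>c\<close>.\<close>
    thus "\<theta> (flip_map J x) i = (shift \<circ> flip_map K) (\<theta> x) i"
      by (simp add: shift_def flip_map_def c_def)
  qed
  moreover have "\<theta> (shift x) = shift (\<theta> x)" for x
    by (simp add: \<theta>_def shift_def)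
  ultimately show ?thesis
    unfolding skew_D_infinity_conjugate_def D_infinity_conjugate_def
    using flip_system_shift_space[OF assms(1)] flip_system_shift_space[OF assms(2)]
      flip_system_comp homeo by blast
qed

end
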